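(* Suppose the covering linear program $P^{\mathrm{covering}}:\ \min\{\mathbf c^T\mathbf x\mid\mathbf A\mathbf x\ge\mathbf b,\ \mathbf x\ge\mathbf 0\}$ is generated according to Generative Model 3 (defined in the context). Let $\boldsymbol\xi$ be the uniform distribution over $[n]$, i.e., $\xi_j=1/n$ for all $j\in[n]$. Let $\delta\in(0,1)$ and suppose that $n>\log(m/\delta)/\big[2(\min_{i\in[m]}q_i)^2\big]$. Set $$C=\max_{i\in[m]}b_i\cdot\frac{1}{\min_{i'\in[m]}q_{i'}-\sqrt{\frac{1}{2n}\log\frac m\delta}}.$$ Then with probability at least $1-\delta$, both $P^{\mathrm{covering}}$ and $P^{\mathrm{covering}}_{\mathrm{distr}}$ are feasible and $$\Delta v(P^{\mathrm{covering}}_{\mathrm{distr}})\le\frac{\max_{i\in[m]}b_i}{\sqrt n}\cdot\frac{1}{\min_{i'\in[m]}q_{i'}-\sqrt{\frac{1}{2n}\log\frac m\delta}}.$$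
   Context: Generative Model 3 produces $(\mathbf A,\mathbf b,\mathbf c)$ as follows: (1) fix probabilities $q_1,\dots,q_m\in(0,1)$; (2) fix any $\mathbf b\in\mathbb R^m$ with $\mathbf b\ge\mathbf 0$; (3) generate the entries of $\mathbf A=[\mathbf A_1\cdots\mathbf A_n]\in\{0,1\}^{m\times n}$ independently with $A_{i,j}\sim\mathrm{Bernoulli}(q_i)$; (4) if $\{\mathbf x\mid\mathbf A\mathbf x\ge\mathbf b,\mathbf x\ge\mathbf 0\}$ is non-empty, fix any $\mathbf c\in\mathbb R^n$ with $\|\mathbf c\|_2=1$ such that $v(P^{\mathrm{covering}})\ge0$; otherwise fix any $\mathbf c\in\mathbb R^n$ with $\|\mathbf c\|_2=1$ ($\mathbf c$ is chosen after $\mathbf A$ and $\mathbf b$ and may depend on them; the manner of choice is otherwise arbitrary). $P^{\mathrm{covering}}_{\mathrm{distr}}:\ \min\{\mathbf c^T\mathbf x\mid\mathbf A\mathbf x\ge\mathbf b,\ \mathbf x\le C\boldsymbol\xi,\ \mathbf x\ge\mathbf 0\}$. $v(\cdot)$ denotes the optimal value and $\Delta v(P^{\mathrm{covering}}_{\mathrm{distr}})=v(P^{\mathrm{covering}}_{\mathrm{distr}})-v(P^{\mathrm{covering}})$. $[n]=\{1,\dots,n\}$, $[m]=\{1,\dots,m\}$. *)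

theory Defs
  imports "HOL-Probability.Probability"
begin

text \<open>
  Inequalities between vectors are the componentwise order on \<^typ>\<open>real^'n\<close>.
\<close>

definition covering_feasible :: "real^'n^'m \<Rightarrow> real^'m \<Rightarrow> (real^'n) set" where
  "covering_feasible A b = {x. A *v x \<ge> b \<and> x \<ge> 0}"

definition covering_distr_feasible ::
    "real^'n^'m \<Rightarrow> real^'m \<Rightarrow> real \<Rightarrow> real^'n \<Rightarrow> (real^'n) set" where
  "covering_distr_feasible A b C \<xi> = {x. A *v x \<ge> b \<and> x \<le> C *\<^sub>R \<xi> \<and> x \<ge> 0}"

text \<open>
  The optimal value is extended-real: \<open>\<infinity>\<close> for an infeasible and \<open>-\<infinity>\<close> for an unbounded program.
\<close>

definition lp_min_value :: "real^'n \<Rightarrow> (real^'n) set \<Rightarrow> ereal" where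
  "lp_min_value c S = (INF x\<in>S. ereal (c \<bullet> x))"

definition covering_value :: "real^'n^'m \<Rightarrow> real^'m \<Rightarrow> real^'n \<Rightarrow> ereal" where
  "covering_value A b c = lp_min_value c (covering_feasible A b)"

definition covering_distr_value ::
    "real^'n^'m \<Rightarrow> real^'m \<Rightarrow> real^'n \<Rightarrow> real \<Rightarrow> real^'n \<Rightarrow> ereal" where
  "covering_distr_value A b c C \<xi> = lp_min_value c (covering_distr_feasible A b C \<xi>)"

definition covering_gap ::
    "real^'n^'m \<Rightarrow> real^'m \<Rightarrow> real^'n \<Rightarrow> real \<Rightarrow> real^'n \<Rightarrow> ereal" where
  "covering_gap A b c C \<xi> = covering_distr_value A b c C \<xi> - covering_value A b c"

text \<open>
  The cost vector \<open>c\<close> is an arbitrary random vector on the same probability space as \<open>A\<close>, so it may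
  depend on \<open>A\<close> in any way, with or without additional randomness. Since \<open>A\<close> takes only finitely
  many values, measurability of \<open>c\<close> is automatic if \<open>c\<close> is a function of \<open>A\<close>.
\<close>

definition generative_model_3 ::
    "'w measure \<Rightarrow> real^'m \<Rightarrow> real^'m \<Rightarrow> ('w \<Rightarrow> real^'n^'m) \<Rightarrow> ('w \<Rightarrow> real^'n) \<Rightarrow> bool" where
  "generative_model_3 M q b A c \<longleftrightarrow>
     prob_space M \<and>
     (\<forall>i. 0 < q $ i \<and> q $ i < 1) \<and>
     b \<ge> 0 \<and>
     (\<forall>\<omega>\<in>space M. \<forall>i j. A \<omega> $ i $ j \<in> {0, 1}) \<and>
     prob_space.indep_vars M (\<lambda>_. borel) (\<lambda>(i, j) \<omega>. A \<omega> $ i $ j) UNIV \<and>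
     (\<forall>i j. distr M borel (\<lambda>\<omega>. A \<omega> $ i $ j)
              = distr (measure_pmf (bernoulli_pmf (q $ i))) borel of_bool) \<and>
     c \<in> borel_measurable M \<and>
     (\<forall>\<omega>\<in>space M. norm (c \<omega>) = 1 \<and>
        (covering_feasible (A \<omega>) b \<noteq> {} \<longrightarrow> covering_value (A \<omega>) b (c \<omega>) \<ge> 0))"

end

theory Submission
  imports Defs
begin

text \<open>
  By Hoeffding's inequality and a union bound over the rows, with probability at least \<open>1 - \<delta>\<close>
  every row of \<open>A\<close> sums to more than \<open>n (min\<^sub>i q\<^sub>i - t)\<close>, where
  \<open>t\<^sup>2 = ln (m / \<delta>) / (2 n)\<close>. Then the constant vector \<open>C \<xi>\<close> is feasible for both programs, and
  its cost is at most \<open>\<parallel>c\<parallel> \<parallel>C \<xi>\<parallel> = C / sqrt n\<close> by Cauchy-Schwarz. As the optimal value of the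
  covering program is nonnegative, this cost bounds the gap.
\<close>

section \<open>Measurability of the optimal values, finiteness of the 0/1 matrices\<close>

lemma lp_min_value_le: "x \<in> S \<Longrightarrow> lp_min_value c S \<le> ereal (c \<bullet> x)"
  unfolding lp_min_value_def by (rule INF_lower)

lemma borel_measurable_lp_min_value:
  "(\<lambda>c. lp_min_value c S) \<in> borel_measurable borel"
proof (rule borel_measurableI_less)
  fix y :: ereal
  \<comment> \<open>\<open>S\<close> may be uncountable, but an infimum of continuous functions is upper semicontinuous\<close>
  have "{c. lp_min_value c S < y} = (\<Union>x\<in>S. {c. ereal (c \<bullet> x) < y})"
    by (auto simp: lp_min_value_def INF_less_iff)
  moreover have "open {c. ereal (c \<bullet> x) < y}" for x
    by (intro open_Collect_less continuous_intros)
  ultimately show "{c \<in> space borel. lp_min_value c S < y} \<in> sets borel"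
    by (auto intro!: borel_open)
qed

lemma borel_measurable_covering_gap:
  "(\<lambda>c. covering_gap A b c C \<xi>) \<in> borel_measurable borel"
  unfolding covering_gap_def covering_distr_value_def covering_value_def
  by (intro borel_measurable_ereal_diff borel_measurable_lp_min_value)

text \<open>Serves to reduce measurability of events involving the random matrix to the case of a
  fixed matrix. A 0/1 matrix is the indicator of the positions of its ones, and there are finitely
  many sets of positions.\<close>

lemma finite_01_matrices:
  "finite {B :: real^'n^'m. \<forall>i j. B $ i $ j \<in> {0, 1}}"
proof (rule finite_subset)
  show "{B :: real^'n^'m. \<forall>i j. B $ i $ j \<in> {0, 1}}
      \<subseteq> range (\<lambda>S. \<chi> i j. of_bool ((i, j) \<in> S))"
  proof
    fix B :: "real^'n^'m"
    assume "B \<in> {B. \<forall>i j. B $ i $ j \<in> {0, 1}}"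
    then have "B $ i $ j \<noteq> 1 \<Longrightarrow> B $ i $ j = 0" for i j
      by blast
    then have "B = (\<chi> i j. of_bool ((i, j) \<in> {(i, j). B $ i $ j = 1}))"
      by (auto simp: vec_eq_iff)
    then show "B \<in> range (\<lambda>S. \<chi> i j. of_bool ((i, j) \<in> S))"
      by (rule range_eqI)
  qed
qed simp

section \<open>Deterministic bounds from the uniform vector\<close>

text \<open>Subtracting a nonnegative covering value can only lower the restricted value, which is
  at most the cost of \<open>x\<close>. The covering value lies between 0 and that cost, hence is
  finite, so the extended-real difference is never of the form \<infinity> - \<infinity>.\<close>

lemma covering_gap_le_cost:
  assumes x: "x \<in> covering_distr_feasible A b C \<xi>"
    and nonneg: "covering_value A b c \<ge> 0"
  shows "covering_gap A b c C \<xi> \<le> ereal (c \<bullet> x)"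
proof -
  have "x \<in> covering_feasible A b"
    using x by (auto simp: covering_distr_feasible_def covering_feasible_def)
  then have "covering_value A b c \<le> ereal (c \<bullet> x)"
    unfolding covering_value_def by (rule lp_min_value_le)
  moreover have "covering_distr_value A b c C \<xi> \<le> ereal (c \<bullet> x)"
    unfolding covering_distr_value_def using x by (rule lp_min_value_le)
  ultimately show ?thesis
    using nonneg unfolding covering_gap_def
    by (cases "covering_value A b c"; cases "covering_distr_value A b c C \<xi>") auto
qed

lemma norm_const_vec: "norm ((\<chi> j. a) :: real^'n) = \<bar>a\<bar> * sqrt (real CARD('n))"
  by (simp add: norm_vec_def L2_set_def real_sqrt_mult mult.commute)

text \<open>All coordinates of \<open>C *\<^sub>R \<xi>\<close> equal C/n, so row i evaluates to C/n
  times its row sum. This is at least C r = \<beta>, which dominates every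
  \<open>b $ i\<close>.\<close>

lemma uniform_vector_covering_distr_feasible:
  fixes A :: "real^'n^'m"
  assumes C: "C = \<beta> * (1 / r)" and \<xi>: "\<xi> = (\<chi> j. 1 / real CARD('n))"
    and r: "r > 0" and \<beta>: "\<And>i. b $ i \<le> \<beta>" "\<beta> \<ge> 0"
    and rows: "\<And>i. real CARD('n) * r \<le> (\<Sum>j\<in>UNIV. A $ i $ j)"
  shows "C *\<^sub>R \<xi> \<in> covering_distr_feasible A b C \<xi>"
proof -
  have "C \<ge> 0"
    using C r \<beta> by simp
  have "b $ i \<le> (A *v (C *\<^sub>R \<xi>)) $ i" for i
  proof -
    have "b $ i \<le> C / real CARD('n) * (real CARD('n) * r)"
      using \<beta>(1)[of i] C r by simp
    also have "\<dots> \<le> C / real CARD('n) * (\<Sum>j\<in>UNIV. A $ i $ j)"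
      using rows[of i] \<open>C \<ge> 0\<close> by (intro mult_left_mono) auto
    also have "\<dots> = (A *v (C *\<^sub>R \<xi>)) $ i"
      by (simp add: \<xi> matrix_vector_mult_def sum_distrib_left mult_ac)
    finally show ?thesis .
  qed
  then show ?thesis
    using \<open>C \<ge> 0\<close> by (auto simp: covering_distr_feasible_def less_eq_vec_def \<xi>)
qed

lemma norm_scaled_uniform_vector:
  fixes \<xi> :: "real^'n"
  assumes "\<xi> = (\<chi> j. 1 / real CARD('n))" "C \<ge> 0"
  shows "norm (C *\<^sub>R \<xi>) = C / sqrt (real CARD('n))"
proof -
  have "norm (C *\<^sub>R \<xi>) = C * (sqrt (real CARD('n)) / real CARD('n))"
    using assms by (simp add: norm_const_vec)
  also have "sqrt (real CARD('n)) / real CARD('n) = 1 / sqrt (real CARD('n))"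
    by (simp add: sqrt_divide_self_eq inverse_eq_divide)
  finally show ?thesis
    by simp
qed

section \<open>Concentration of the row sums, measurability of the final event\<close>

lemma generative_model_3_entry_measurable:
  assumes "generative_model_3 M q b A c"
  shows "(\<lambda>\<omega>. A \<omega> $ i $ j) \<in> borel_measurable M"
proof -
  interpret prob_space M
    using assms by (simp add: generative_model_3_def)
  have "indep_vars (\<lambda>_. borel) (\<lambda>(i, j) \<omega>. A \<omega> $ i $ j) UNIV"
    using assms by (simp add: generative_model_3_def)
  then show ?thesis
    by (auto simp: indep_vars_def)
qed

text \<open>Hoeffding's lower tail for the n independent entries of row i, with total deviation n t.
  The entries lie in [0,1], so the exponent is -2 (n t)^2 / n.\<close>

lemma bernoulli_row_sum_concentration:
  fixes A :: "'w \<Rightarrow> real^'n^'m"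
  assumes model: "generative_model_3 M q b A c" and t: "t \<ge> 0"
  shows "measure M {\<omega> \<in> space M. (\<Sum>j\<in>UNIV. A \<omega> $ i $ j) \<le> real CARD('n) * (q $ i - t)}
    \<le> exp (- 2 * real CARD('n) * t\<^sup>2)"
proof -
  interpret prob_space M
    using model by (simp add: generative_model_3_def)
  define X where "X = (\<lambda>(i, j) \<omega>. A \<omega> $ i $ j)"
  have X: "indep_vars (\<lambda>_. borel) X UNIV"
    and entry: "\<And>\<omega> i j. \<omega> \<in> space M \<Longrightarrow> A \<omega> $ i $ j \<in> {0, 1}"
    and distr: "\<And>i j. distr M borel (\<lambda>\<omega>. A \<omega> $ i $ j)
              = distr (measure_pmf (bernoulli_pmf (q $ i))) borel of_bool"
    and q: "0 < q $ i" "q $ i < 1"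
    using model by (auto simp: generative_model_3_def X_def)
  note rv = generative_model_3_entry_measurable[OF model]
  have E: "expectation (\<lambda>\<omega>. A \<omega> $ i $ j) = q $ i" for j
  proof -
    have "expectation (\<lambda>\<omega>. A \<omega> $ i $ j) = (\<integral>x. x \<partial>distr M borel (\<lambda>\<omega>. A \<omega> $ i $ j))"
      using rv by (subst integral_distr) auto
    also have "\<dots> = measure_pmf.expectation (bernoulli_pmf (q $ i)) of_bool"
      unfolding distr by (subst integral_distr) auto
    finally show ?thesis
      using q by simp
  qed
  \<comment> \<open>Independence is given for the family indexed by pairs, so row i is treated as
    the subfamily of pairs with first component i.\<close>
  define I :: "('m \<times> 'n) set" where "I = Pair i ` UNIV"
  have sum_I: "(\<Sum>p\<in>I. f p) = (\<Sum>j\<in>UNIV. f (i, j))" for f :: "_ \<Rightarrow> real"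
    unfolding I_def by (subst sum.reindex) (auto simp: inj_on_def)
  have card_I: "card I = CARD('n)"
    unfolding I_def by (rule card_image) (simp add: inj_on_def)
  interpret Hoeffding_ineq M I X "\<lambda>_. 0" "\<lambda>_. 1" "\<Sum>p\<in>I. expectation (X p)"
  proof unfold_locales
    show "finite I" by (simp add: I_def)
    show "indep_vars (\<lambda>_. borel) X I"
      using X by (rule indep_vars_subset) simp
    show "AE \<omega> in M. X p \<omega> \<in> {0..1}" for p
    proof (rule AE_I2)
      fix \<omega> assume "\<omega> \<in> space M"
      then show "X p \<omega> \<in> {0..1}"
        using entry[of \<omega> "fst p" "snd p"] by (auto simp: X_def split_beta)
    qed
  qed simp
  have mean: "(\<Sum>p\<in>I. expectation (X p)) = real CARD('n) * q $ i"
    by (simp add: sum_I X_def E)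
  have "prob {\<omega> \<in> space M. (\<Sum>p\<in>I. X p \<omega>) \<le> (\<Sum>p\<in>I. expectation (X p)) - real CARD('n) * t}
      \<le> exp (- 2 * (real CARD('n) * t)\<^sup>2 / (\<Sum>p\<in>I. (1 - 0)\<^sup>2))"
    using t by (intro Hoeffding_ineq_le) (auto simp: card_I)
  moreover have "- 2 * (real CARD('n) * t)\<^sup>2 / (\<Sum>p\<in>I. (1 - 0)\<^sup>2) = - 2 * real CARD('n) * t\<^sup>2"
    by (simp add: card_I power2_eq_square)
  ultimately show ?thesis
    unfolding mean by (simp add: sum_I X_def right_diff_distrib)
qed

text \<open>Union bound: each of the m rows fails with probability at most the Hoeffding bound, and
  the complement of all failures is the stated event.\<close>

lemma all_rows_concentration:
  fixes A :: "'w \<Rightarrow> real^'n^'m"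
  assumes model: "generative_model_3 M q b A c" and t: "t \<ge> 0"
  shows "measure M {\<omega> \<in> space M. \<forall>i. real CARD('n) * (q $ i - t) < (\<Sum>j\<in>UNIV. A \<omega> $ i $ j)}
    \<ge> 1 - real CARD('m) * exp (- 2 * real CARD('n) * t\<^sup>2)"
proof -
  interpret prob_space M
    using model by (simp add: generative_model_3_def)
  note [measurable] = generative_model_3_entry_measurable[OF model]
  define F where
    "F i = {\<omega> \<in> space M. (\<Sum>j\<in>UNIV. A \<omega> $ i $ j) \<le> real CARD('n) * (q $ i - t)}" for i
  have F: "F i \<in> events" for i
    unfolding F_def by measurable
  have "prob (\<Union>i. F i) \<le> (\<Sum>i\<in>UNIV. prob (F i))"
    using F by (intro finite_measure_subadditive_finite) auto
  also have "\<dots> \<le> (\<Sum>i\<in>(UNIV :: 'm set). exp (- 2 * real CARD('n) * t\<^sup>2))"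
    unfolding F_def using bernoulli_row_sum_concentration[OF model t] by (intro sum_mono) auto
  also have "\<dots> = real CARD('m) * exp (- 2 * real CARD('n) * t\<^sup>2)"
    by simp
  finally have "1 - real CARD('m) * exp (- 2 * real CARD('n) * t\<^sup>2) \<le> prob (space M - (\<Union>i. F i))"
    using F by (subst prob_compl) auto
  also have "space M - (\<Union>i. F i)
      = {\<omega> \<in> space M. \<forall>i. real CARD('n) * (q $ i - t) < (\<Sum>j\<in>UNIV. A \<omega> $ i $ j)}"
    by (auto simp: F_def simp flip: not_le)
  finally show ?thesis .
qed

text \<open>
  Needed because a non-measurable event would get the junk probability \<open>0\<close>. As \<open>A\<close> takes finitely
  many values, it suffices to treat each of them separately.
\<close>

lemma covering_event_measurable:
  fixes A :: "'w \<Rightarrow> real^'n^'m"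
  assumes model: "generative_model_3 M q b A c"
  shows "{\<omega> \<in> space M. covering_feasible (A \<omega>) b \<noteq> {} \<and>
      covering_distr_feasible (A \<omega>) b C \<xi> \<noteq> {} \<and> covering_gap (A \<omega>) b (c \<omega>) C \<xi> \<le> y} \<in> sets M"
proof -
  note [measurable] = generative_model_3_entry_measurable[OF model]
  have c [measurable]: "c \<in> borel_measurable M"
    using model by (simp add: generative_model_3_def)
  let ?S = "{B :: real^'n^'m. \<forall>i j. B $ i $ j \<in> {0, 1}}"
  have A: "A \<in> measurable M (count_space ?S)"
  proof (subst measurable_count_space_eq2[OF finite_01_matrices], intro conjI ballI)
    show "A \<in> space M \<rightarrow> ?S"
      using model by (auto simp: generative_model_3_def)
    \<comment> \<open>The target is finite, so it suffices that the preimages of single matrices are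
      measurable; each is a finite conjunction of conditions on entries.\<close>
    fix B :: "real^'n^'m"
    have "A -` {B} \<inter> space M = {\<omega> \<in> space M. \<forall>i j. A \<omega> $ i $ j = B $ i $ j}"
      by (auto simp: vec_eq_iff)
    also have "\<dots> \<in> sets M"
      by measurable
    finally show "A -` {B} \<inter> space M \<in> sets M" .
  qed
  have "(\<lambda>\<omega>. covering_gap B b (c \<omega>) C \<xi>) \<in> borel_measurable M" for B :: "real^'n^'m"
    using measurable_compose[OF c borel_measurable_covering_gap] .
  \<comment> \<open>With the matrix fixed, both feasibility conditions are constant and only the gap
    depends on \<omega>, through \<open>c\<close>.\<close>
  then have "Measurable.pred M (\<lambda>\<omega>. covering_feasible B b \<noteq> {} \<and>
      covering_distr_feasible B b C \<xi> \<noteq> {} \<and> covering_gap B b (c \<omega>) C \<xi> \<le> y)"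
    for B :: "real^'n^'m"
    by measurable
  then have "Measurable.pred M (\<lambda>\<omega>. covering_feasible (A \<omega>) b \<noteq> {} \<and>
      covering_distr_feasible (A \<omega>) b C \<xi> \<noteq> {} \<and> covering_gap (A \<omega>) b (c \<omega>) C \<xi> \<le> y)"
    by (rule measurable_compose_countable'[OF _ A countable_finite[OF finite_01_matrices]])
  then show ?thesis
    by (simp add: pred_def)
qed

section \<open>Choice of the deviation and the final estimate\<close>

theorem theorem6:
  fixes M :: "'w measure"
    and q b :: "real^'m"
    and A :: "'w \<Rightarrow> real^'n^'m"
    and c :: "'w \<Rightarrow> real^'n"
    and \<xi> :: "real^'n"
    and \<delta> C :: real
  assumes model: "generative_model_3 M q b A c"
    and xi: "\<xi> = (\<chi> j. 1 / real CARD('n))"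
    and delta: "0 < \<delta>" "\<delta> < 1"
    and n_large: "real CARD('n) > ln (real CARD('m) / \<delta>) / (2 * (MIN i. q $ i)^2)"
    and C: "C = (MAX i. b $ i) *
              (1 / ((MIN i. q $ i) - sqrt (1 / (2 * real CARD('n)) * ln (real CARD('m) / \<delta>))))"
  shows "\<P>(\<omega> in M.
            covering_feasible (A \<omega>) b \<noteq> {} \<and>
            covering_distr_feasible (A \<omega>) b C \<xi> \<noteq> {} \<and>
            covering_gap (A \<omega>) b (c \<omega>) C \<xi> \<le>
              ereal ((MAX i. b $ i) / sqrt (real CARD('n)) *
                (1 / ((MIN i. q $ i) -
                   sqrt (1 / (2 * real CARD('n)) * ln (real CARD('m) / \<delta>))))))
         \<ge> 1 - \<delta>"
proof -
  interpret prob_space M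
    using model by (simp add: generative_model_3_def)
  define n where "n = real CARD('n)"
  define L where "L = ln (real CARD('m) / \<delta>)"
  define t where "t = sqrt (1 / (2 * n) * L)"
  define qmin where "qmin = (MIN i. q $ i)"
  define \<beta> where "\<beta> = (MAX i. b $ i)"
  have n: "n > 0"
    by (simp add: n_def)
  \<comment> \<open>Since \<delta> < 1 \<le> m, the logarithm \<open>L\<close> is nonnegative, so
    squaring \<open>t\<close> really gives L / (2 n).\<close>
  have "real CARD('m) \<ge> 1"
    by (simp add: Suc_le_eq)
  then have "\<delta> \<le> real CARD('m)"
    using delta by linarith
  then have "real CARD('m) / \<delta> \<ge> 1"
    using delta by (simp add: le_divide_eq)
  then have "L \<ge> 0"
    by (simp add: L_def)
  then have t0: "t \<ge> 0" and t2: "2 * n * t\<^sup>2 = L"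
    using n by (auto simp: t_def)
  have qmin_le: "qmin \<le> q $ i" for i
    unfolding qmin_def by (rule Min_le) auto
  have "qmin \<in> range (($) q)"
    unfolding qmin_def by (rule Min_in) auto
  then have "qmin > 0"
    using model by (auto simp: generative_model_3_def)
  \<comment> \<open>The lower bound on n says exactly that \<open>t\<close> is below
    \<open>qmin\<close>, which makes the denominator in \<open>C\<close> positive.\<close>
  have "L / (2 * qmin\<^sup>2) < n"
    using n_large by (simp add: L_def n_def qmin_def)
  then have "L < n * (2 * qmin\<^sup>2)"
    using \<open>qmin > 0\<close> by (simp add: pos_divide_less_eq)
  then have "t\<^sup>2 < qmin\<^sup>2"
    using n by (simp flip: t2)
  then have r: "qmin - t > 0"
    using power2_less_imp_less[of t qmin] \<open>qmin > 0\<close> by simp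
  have b_le: "b $ i \<le> \<beta>" for i
    unfolding \<beta>_def by (rule Max_ge) auto
  have "b \<ge> 0"
    using model by (simp add: generative_model_3_def)
  then have \<beta>0: "\<beta> \<ge> 0"
    using order_trans[OF _ b_le] by (auto simp: less_eq_vec_def)
  have C': "C = \<beta> * (1 / (qmin - t))"
    by (simp add: C \<beta>_def qmin_def t_def n_def L_def)
  then have "C \<ge> 0"
    using \<beta>0 r by simp
  let ?bound = "\<beta> / sqrt n * (1 / (qmin - t))"
  let ?G = "{\<omega> \<in> space M. \<forall>i. n * (q $ i - t) < (\<Sum>j\<in>UNIV. A \<omega> $ i $ j)}"
  let ?E = "{\<omega> \<in> space M. covering_feasible (A \<omega>) b \<noteq> {} \<and>
      covering_distr_feasible (A \<omega>) b C \<xi> \<noteq> {} \<and>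
      covering_gap (A \<omega>) b (c \<omega>) C \<xi> \<le> ereal ?bound}"
  \<comment> \<open>\<open>t\<close> is calibrated so that each row fails with probability at most
    \<delta>/m, hence some row with probability at most \<delta>.\<close>
  have "exp (- 2 * n * t\<^sup>2) = exp (- L)"
    by (simp flip: t2)
  also have "\<dots> = \<delta> / real CARD('m)"
    using delta by (simp add: L_def exp_minus)
  finally have "1 - \<delta> \<le> prob ?G"
    using all_rows_concentration[OF model t0] by (simp add: n_def)
  also have "\<dots> \<le> prob ?E"
  proof (rule finite_measure_mono)
    show "?G \<subseteq> ?E"
    proof safe
      fix \<omega> assume \<omega>: "\<omega> \<in> space M"
        and rows: "\<forall>i. n * (q $ i - t) < (\<Sum>j\<in>UNIV. A \<omega> $ i $ j)"
      have row: "real CARD('n) * (qmin - t) \<le> (\<Sum>j\<in>UNIV. A \<omega> $ i $ j)" for i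
      proof -
        have "n * (qmin - t) \<le> n * (q $ i - t)"
          using qmin_le n by simp
        also have "\<dots> \<le> (\<Sum>j\<in>UNIV. A \<omega> $ i $ j)"
          using rows by (simp add: less_imp_le)
        finally show ?thesis
          unfolding n_def .
      qed
      have x: "C *\<^sub>R \<xi> \<in> covering_distr_feasible (A \<omega>) b C \<xi>"
        using C' xi r b_le \<beta>0 row by (rule uniform_vector_covering_distr_feasible)
      then have x': "C *\<^sub>R \<xi> \<in> covering_feasible (A \<omega>) b"
        by (auto simp: covering_distr_feasible_def covering_feasible_def)
      show "covering_distr_feasible (A \<omega>) b C \<xi> = {} \<Longrightarrow> False"
        "covering_feasible (A \<omega>) b = {} \<Longrightarrow> False"
        using x x' by auto
      \<comment> \<open>The model guarantees a nonnegative value only when the covering program is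
        feasible, which \<open>x'\<close> supplies.\<close>
      have c: "norm (c \<omega>) = 1" "covering_value (A \<omega>) b (c \<omega>) \<ge> 0"
        using model \<omega> x' by (auto simp: generative_model_3_def)
      have "c \<omega> \<bullet> (C *\<^sub>R \<xi>) \<le> norm (c \<omega>) * norm (C *\<^sub>R \<xi>)"
        by (rule norm_cauchy_schwarz)
      also have "\<dots> = ?bound"
        using norm_scaled_uniform_vector[OF xi \<open>C \<ge> 0\<close>] by (simp add: c C' n_def)
      finally show "covering_gap (A \<omega>) b (c \<omega>) C \<xi> \<le> ereal ?bound"
        using covering_gap_le_cost[OF x c(2)] by (meson ereal_less_eq(3) order_trans)
    qed
    show "?E \<in> events"
      by (rule covering_event_measurable[OF model])
  qed
  finally show ?thesis
    by (simp add: \<beta>_def qmin_def t_def n_def L_def)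
qed

end
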